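(* Let $\{R_1,R_2,R_3\}$ be three pairwise commuting Rota-Baxter operators (of weight zero) of a Lie algebra $\mathfrak g$. Then there exists an L-quadri-algebra structure on $\mathfrak g$ defined, for $x,y\in\mathfrak g$, by $$x\searrow y=[R_1(R_2(R_3(x))),y],\quad x\nwarrow y=[R_3(x),R_1(R_2(y))],$$ $$x\nearrow y=[R_2(R_3(x)),R_1(y)],\quad x\swarrow y=[R_1(R_3(x)),R_2(y)].$$
   Context: All algebras are finite-dimensional over a field of characteristic zero. A Rota-Baxter operator (of weight zero) on a Lie algebra $\mathfrak g$ is a linear map $R:\mathfrak g\to\mathfrak g$ with $[R(x),R(y)]=R([R(x),y]+[x,R(y)])$ for all $x,y\in\mathfrak g$. An L-quadri-algebra $(A,\searrow,\nearrow,\nwarrow,\swarrow)$ is a vector space with four bilinear products such that for all $x,y,z\in A$: $x\searrow(y\searrow z)-(x\ast y)\searrow z=y\searrow(x\searrow z)-(y\ast x)\searrow z$; $x\searrow(y\nearrow z)-(x\vee y)\nearrow z=y\nearrow(x\succ z)-(y\wedge x)\nearrow z$; $x\searrow(y\nwarrow z)-(x\searrow y)\nwarrow z=y\nwarrow(x\ast z)-(y\nwarrow x)\nwarrow z$; $x\nearrow(y\prec z)-(x\nearrow y)\nwarrow z=y\swarrow(x\wedge z)-(y\swarrow x)\nwarrow z$; $x\searrow(y\swarrow z)-(x\succ y)\swarrow z=y\swarrow(x\vee z)-(y\prec x)\swarrow z$; where $x\succ y=x\searrow y+x\nearrow y$, $x\prec y=x\nwarrow y+x\swarrow y$, $x\vee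 y=x\searrow y+x\swarrow y$, $x\wedge y=x\nearrow y+x\nwarrow y$, $x\ast y=x\searrow y+x\nearrow y+x\nwarrow y+x\swarrow y$. *)

theory Defs
  imports Complex_Main
begin

locale findim_space = vector_space scale
  for scale :: "'k::field_char_0 \<Rightarrow> 'v::ab_group_add \<Rightarrow> 'v" +
  assumes finite_dim: "\<exists>B. finite_dimensional_vector_space scale B"

definition bilinear_op ::
  "('k::field_char_0 \<Rightarrow> 'v::ab_group_add \<Rightarrow> 'v) \<Rightarrow> ('v \<Rightarrow> 'v \<Rightarrow> 'v) \<Rightarrow> bool" where
  "bilinear_op scale f \<longleftrightarrow>
     (\<forall>x. Vector_Spaces.linear scale scale (\<lambda>y. f x y)) \<and>
     (\<forall>y. Vector_Spaces.linear scale scale (\<lambda>x. f x y))"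

locale lie_algebra = findim_space scale
  for scale :: "'k::field_char_0 \<Rightarrow> 'g::ab_group_add \<Rightarrow> 'g" +
  fixes bracket :: "'g \<Rightarrow> 'g \<Rightarrow> 'g"
  assumes bilinear_bracket: "bilinear_op scale bracket"
    and alternating: "bracket x x = 0"
    and jacobi:
      "bracket x (bracket y z) + bracket y (bracket z x) + bracket z (bracket x y) = 0"

definition (in lie_algebra) rota_baxter :: "('g \<Rightarrow> 'g) \<Rightarrow> bool" where
  "rota_baxter R \<longleftrightarrow>
     Vector_Spaces.linear scale scale R \<and>
     (\<forall>x y. bracket (R x) (R y) = R (bracket (R x) y + bracket x (R y)))"

locale quadri_products =
  fixes se :: "'v::ab_group_add \<Rightarrow> 'v \<Rightarrow> 'v" (infixl "\<searrow>" 70)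
    and ne :: "'v \<Rightarrow> 'v \<Rightarrow> 'v" (infixl "\<nearrow>" 70)
    and nw :: "'v \<Rightarrow> 'v \<Rightarrow> 'v" (infixl "\<nwarrow>" 70)
    and sw :: "'v \<Rightarrow> 'v \<Rightarrow> 'v" (infixl "\<swarrow>" 70)
begin

definition succ_prod (infixl "\<succ>" 70) where "x \<succ> y = x \<searrow> y + x \<nearrow> y"
definition prec_prod (infixl "\<prec>" 70) where "x \<prec> y = x \<nwarrow> y + x \<swarrow> y"
definition vee_prod (infixl "\<or>\<^sub>A" 70) where "x \<or>\<^sub>A y = x \<searrow> y + x \<swarrow> y"
definition wedge_prod (infixl "\<and>\<^sub>A" 70) where "x \<and>\<^sub>A y = x \<nearrow> y + x \<nwarrow> y"
definition star_prod (infixl "*\<^sub>A" 70) where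
  "x *\<^sub>A y = x \<searrow> y + x \<nearrow> y + x \<nwarrow> y + x \<swarrow> y"

end

locale L_quadri_algebra = findim_space scale + quadri_products se ne nw sw
  for scale :: "'k::field_char_0 \<Rightarrow> 'v::ab_group_add \<Rightarrow> 'v"
    and se :: "'v \<Rightarrow> 'v \<Rightarrow> 'v" (infixl "\<searrow>" 70)
    and ne :: "'v \<Rightarrow> 'v \<Rightarrow> 'v" (infixl "\<nearrow>" 70)
    and nw :: "'v \<Rightarrow> 'v \<Rightarrow> 'v" (infixl "\<nwarrow>" 70)
    and sw :: "'v \<Rightarrow> 'v \<Rightarrow> 'v" (infixl "\<swarrow>" 70) +
  assumes bilinear_se: "bilinear_op scale se"
    and bilinear_ne: "bilinear_op scale ne"
    and bilinear_nw: "bilinear_op scale nw"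
    and bilinear_sw: "bilinear_op scale sw"
    and quadri1: "x \<searrow> (y \<searrow> z) - (x *\<^sub>A y) \<searrow> z = y \<searrow> (x \<searrow> z) - (y *\<^sub>A x) \<searrow> z"
    and quadri2: "x \<searrow> (y \<nearrow> z) - (x \<or>\<^sub>A y) \<nearrow> z = y \<nearrow> (x \<succ> z) - (y \<and>\<^sub>A x) \<nearrow> z"
    and quadri3: "x \<searrow> (y \<nwarrow> z) - (x \<searrow> y) \<nwarrow> z = y \<nwarrow> (x *\<^sub>A z) - (y \<nwarrow> x) \<nwarrow> z"
    and quadri4: "x \<nearrow> (y \<prec> z) - (x \<nearrow> y) \<nwarrow> z = y \<swarrow> (x \<and>\<^sub>A z) - (y \<swarrow> x) \<nwarrow> z"
    and quadri5: "x \<searrow> (y \<swarrow> z) - (x \<succ> y) \<swarrow> z = y \<swarrow> (x \<or>\<^sub>A z) - (y \<prec> x) \<swarrow> z"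

end

theory Submission imports Defs begin

text \<open>Each L-quadri axiom has the form $[p,[q,w]] - [r,w] = [q,[p,w]] - [s,w]$ once inner sums
  such as $R_1([R_1 a,b]+[a,R_1 b])$ are folded into $[R_1 a,R_1 b]$. By the Jacobi identity it then
  suffices that $[p,q] = r - s$, which follows by expanding $[p,q]$ with the Rota-Baxter identity,
  once for each operator common to $p$ and $q$.\<close>

text \<open>Each of the four products is the bracket with linear maps inserted in its two slots, so
  all the bilinearity conditions come from this.\<close>

lemma bilinear_op_compose:
  assumes "bilinear_op scale f"
    and "Vector_Spaces.linear scale scale S" "Vector_Spaces.linear scale scale T"
  shows "bilinear_op scale (\<lambda>x y. f (S x) (T y))"
  using assms Vector_Spaces.linear_compose[OF assms(2)] Vector_Spaces.linear_compose[OF assms(3)]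
  unfolding bilinear_op_def comp_def by blast

context lie_algebra
begin

lemma bracket_add_left: "bracket (x + y) z = bracket x z + bracket y z"
  and bracket_add_right: "bracket x (y + z) = bracket x y + bracket x z"
  and bracket_diff_left: "bracket (x - y) z = bracket x z - bracket y z"
  and bracket_minus_right: "bracket x (- y) = - bracket x y"
proof -
  interpret l: Vector_Spaces.linear scale scale "\<lambda>x. bracket x z"
    using bilinear_bracket by (simp add: bilinear_op_def)
  interpret r: Vector_Spaces.linear scale scale "\<lambda>y. bracket x y"
    using bilinear_bracket by (simp add: bilinear_op_def)
  show "bracket (x + y) z = bracket x z + bracket y z" by (rule l.add)
  show "bracket x (y + z) = bracket x y + bracket x z" by (rule r.add)
  show "bracket (x - y) z = bracket x z - bracket y z" by (rule l.diff)
  show "bracket x (- y) = - bracket x y" by (rule r.neg)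
qed

lemma bracket_anticommute: "bracket y x = - bracket x y"
proof -
  have "bracket x y + bracket y x = bracket (x + y) (x + y)"
    by (simp only: bracket_add_left bracket_add_right) (simp add: alternating)
  then show ?thesis
    by (simp add: alternating eq_neg_iff_add_eq_0 add.commute)
qed

text \<open>Jacobi as a commutator of left multiplications: the two double brackets differ by
  \<open>bracket (bracket p q) w\<close>. The five axioms use it with \<open>w\<close> equal to
  \<open>z\<close>, \<open>R1 z\<close>, \<open>R1 (R2 z)\<close> (twice) and
  \<open>R2 z\<close>.\<close>

lemma jacobi_exchange:
  assumes "bracket p q = r - s"
  shows "bracket p (bracket q w) - bracket r w = bracket q (bracket p w) - bracket s w"
proof -
  have "bracket q (bracket w p) = - bracket q (bracket p w)"
    using bracket_anticommute[of w p] by (simp add: bracket_minus_right)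
  moreover have "bracket w (bracket p q) = bracket s w - bracket r w"
    using bracket_anticommute[of w "r - s"] by (simp add: assms bracket_diff_left)
  ultimately have "bracket p (bracket q w) - bracket q (bracket p w) + (bracket s w - bracket r w) = 0"
    using jacobi[of p q w] by simp
  then show ?thesis
    by (simp add: algebra_simps)
qed

lemma rota_baxter_linear: "rota_baxter R \<Longrightarrow> Vector_Spaces.linear scale scale R"
  by (simp add: rota_baxter_def)

lemma rota_baxter_add: "rota_baxter R \<Longrightarrow> R (x + y) = R x + R y"
  and rota_baxter_minus: "rota_baxter R \<Longrightarrow> R (- x) = - R x"
  and rota_baxter_diff: "rota_baxter R \<Longrightarrow> R (x - y) = R x - R y"
  by (simp_all add: rota_baxter_def Vector_Spaces.linear_iff_module_hom
      module_hom.add[of scale scale R] module_hom.neg[of scale scale R]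
      module_hom.diff[of scale scale R])

lemma rota_baxter_bracket:
  "rota_baxter R \<Longrightarrow> bracket (R x) (R y) = R (bracket (R x) y) + R (bracket x (R y))"
  by (metis rota_baxter_add rota_baxter_def)

end

theorem corollary3p16:
  fixes scale :: "'k::field_char_0 \<Rightarrow> 'g::ab_group_add \<Rightarrow> 'g"
    and bracket :: "'g \<Rightarrow> 'g \<Rightarrow> 'g"
    and R1 R2 R3 :: "'g \<Rightarrow> 'g"
  assumes "lie_algebra scale bracket"
    and "lie_algebra.rota_baxter scale bracket R1"
    and "lie_algebra.rota_baxter scale bracket R2"
    and "lie_algebra.rota_baxter scale bracket R3"
    and "R1 \<circ> R2 = R2 \<circ> R1"
    and "R1 \<circ> R3 = R3 \<circ> R1"
    and "R2 \<circ> R3 = R3 \<circ> R2"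
  shows "L_quadri_algebra scale
           (\<lambda>x y. bracket (R1 (R2 (R3 x))) y)
           (\<lambda>x y. bracket (R2 (R3 x)) (R1 y))
           (\<lambda>x y. bracket (R3 x) (R1 (R2 y)))
           (\<lambda>x y. bracket (R1 (R3 x)) (R2 y))"
proof -
  interpret lie_algebra scale bracket by fact
  note RB = assms(2-4)
  have comm: "R2 (R1 a) = R1 (R2 a)" "R3 (R1 a) = R1 (R3 a)" "R3 (R2 a) = R2 (R3 a)" for a
    using assms(5-7) by (metis comp_apply)+
  \<comment> \<open>Simplifying with \<open>comm\<close> moves $R_1$ outermost and $R_3$ innermost, so the identities for
    $R_2$ and $R_3$ are also needed with the outer operators in front.\<close>
  note add = RB[THEN rota_baxter_add]
  note rb1 = rota_baxter_bracket[OF RB(1)]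
  note rb2 = rota_baxter_bracket[OF RB(2)]
    rota_baxter_bracket[OF RB(2), where x = "R1 a" for a, unfolded comm]
    rota_baxter_bracket[OF RB(2), where y = "R1 b" for b, unfolded comm]
  note rb3 = rota_baxter_bracket[OF RB(3)]
    rota_baxter_bracket[OF RB(3), where x = "R1 a" for a, unfolded comm]
    rota_baxter_bracket[OF RB(3), where y = "R1 b" for b, unfolded comm]
    rota_baxter_bracket[OF RB(3), where x = "R2 a" for a, unfolded comm]
    rota_baxter_bracket[OF RB(3), where y = "R2 b" for b, unfolded comm]
    rota_baxter_bracket[OF RB(3), where x = "R1 a" and y = "R2 b" for a b, unfolded comm]
    rota_baxter_bracket[OF RB(3), where x = "R2 a" and y = "R1 b" for a b, unfolded comm]
    rota_baxter_bracket[OF RB(3), where x = "R1 (R2 a)" for a, unfolded comm]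
    rota_baxter_bracket[OF RB(3), where y = "R1 (R2 b)" for b, unfolded comm]
  note lin = RB[THEN rota_baxter_linear]
  have lin12: "Vector_Spaces.linear scale scale (\<lambda>x. R1 (R2 x))"
    and lin13: "Vector_Spaces.linear scale scale (\<lambda>x. R1 (R3 x))"
    and lin23: "Vector_Spaces.linear scale scale (\<lambda>x. R2 (R3 x))"
    using Vector_Spaces.linear_compose[OF lin(2) lin(1)] Vector_Spaces.linear_compose[OF lin(3) lin(1)]
      Vector_Spaces.linear_compose[OF lin(3) lin(2)]
    by (simp_all add: comp_def)
  have lin123: "Vector_Spaces.linear scale scale (\<lambda>x. R1 (R2 (R3 x)))"
    using Vector_Spaces.linear_compose[OF lin(3) lin12] by (simp add: comp_def)
  note bilinear = bilinear_op_compose[OF bilinear_bracket]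
  interpret quadri_products
    "\<lambda>x y. bracket (R1 (R2 (R3 x))) y"
    "\<lambda>x y. bracket (R2 (R3 x)) (R1 y)"
    "\<lambda>x y. bracket (R3 x) (R1 (R2 y))"
    "\<lambda>x y. bracket (R1 (R3 x)) (R2 y)" .
  note defs = succ_prod_def prec_prod_def vee_prod_def wedge_prod_def star_prod_def
  \<comment> \<open>As rewrite rules, the Rota-Baxter identities push operators out of brackets.
    Anticommutativity creates signs underneath these operators, and linearity then moves the signs
    outside.\<close>
  note expand = defs comm add rb1 rb2 rb3 RB[THEN rota_baxter_minus] RB[THEN rota_baxter_diff]
  show ?thesis
  proof
    show "bilinear_op scale (\<lambda>x y. bracket (R1 (R2 (R3 x))) y)"
      by (rule bilinear[OF lin123 linear_ident])
    show "bilinear_op scale (\<lambda>x y. bracket (R2 (R3 x)) (R1 y))"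
      by (rule bilinear[OF lin23 lin(1)])
    show "bilinear_op scale (\<lambda>x y. bracket (R3 x) (R1 (R2 y)))"
      by (rule bilinear[OF lin(3) lin12])
    show "bilinear_op scale (\<lambda>x y. bracket (R1 (R3 x)) (R2 y))"
      by (rule bilinear[OF lin13 lin(2)])
  next
    fix x y z
    \<comment> \<open>In the expanded \<open>bracket p q\<close>, each inner bracket has the three
      operators split between \<open>x\<close> and \<open>y\<close>. Those with \<open>R3\<close> on
      \<open>x\<close> make up \<open>r\<close>; those with \<open>R3\<close> on \<open>y\<close>
      make up \<open>- s\<close> once reversed. The four instances are the possible splits of the
      second sort.\<close>
    note anticommute =
      bracket_anticommute[of x "R1 (R2 (R3 y))"]
      bracket_anticommute[of "R1 x" "R2 (R3 y)"]
      bracket_anticommute[of "R2 x" "R1 (R3 y)"]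
      bracket_anticommute[of "R1 (R2 x)" "R3 y"]
    \<comment> \<open>In all five sums \<open>R3\<close> stays on the first argument, and the
      summands run over all placements of the operators about to be applied: \<open>R1\<close>,
      \<open>R2\<close> or both. The Rota-Baxter identity therefore collapses each sum to one
      bracket.\<close>
    have fold12_star: "R1 (R2 (star_prod x z)) = bracket (R1 (R2 (R3 x))) (R1 (R2 z))"
      by (simp add: expand)
    have fold1_succ: "R1 (succ_prod x z) = bracket (R1 (R2 (R3 x))) (R1 z)"
      by (simp add: expand)
    have fold1_prec: "R1 (prec_prod y z) = bracket (R1 (R3 y)) (R1 (R2 z))"
      by (simp add: expand)
    have fold2_wedge: "R2 (wedge_prod x z) = bracket (R2 (R3 x)) (R1 (R2 z))"
      by (simp add: expand)
    have fold2_vee: "R2 (vee_prod x z) = bracket (R1 (R2 (R3 x))) (R2 z)"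
      by (simp add: expand)
    \<comment> \<open>The second slot of the first product carries no operator, so the exchange
      shape is already present.\<close>
    show "bracket (R1 (R2 (R3 x))) (bracket (R1 (R2 (R3 y))) z) - bracket (R1 (R2 (R3 (star_prod x y)))) z
        = bracket (R1 (R2 (R3 y))) (bracket (R1 (R2 (R3 x))) z) - bracket (R1 (R2 (R3 (star_prod y x)))) z"
      by (rule jacobi_exchange) (simp add: expand anticommute)
    show "bracket (R1 (R2 (R3 x))) (bracket (R2 (R3 y)) (R1 z)) - bracket (R2 (R3 (vee_prod x y))) (R1 z)
        = bracket (R2 (R3 y)) (R1 (succ_prod x z)) - bracket (R2 (R3 (wedge_prod y x))) (R1 z)"
      unfolding fold1_succ by (rule jacobi_exchange) (simp add: expand anticommute)
    show "bracket (R1 (R2 (R3 x))) (bracket (R3 y) (R1 (R2 z)))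
          - bracket (R3 (bracket (R1 (R2 (R3 x))) y)) (R1 (R2 z))
        = bracket (R3 y) (R1 (R2 (star_prod x z))) - bracket (R3 (bracket (R3 y) (R1 (R2 x)))) (R1 (R2 z))"
      unfolding fold12_star by (rule jacobi_exchange) (simp add: expand anticommute)
    \<comment> \<open>This is the only axiom with a sum inside the outer product on both sides,
      hence two folds. Only \<open>R3\<close> is common to \<open>p\<close> and \<open>q\<close>, so
      one expansion gives \<open>bracket p q\<close>.\<close>
    show "bracket (R2 (R3 x)) (R1 (prec_prod y z)) - bracket (R3 (bracket (R2 (R3 x)) (R1 y))) (R1 (R2 z))
        = bracket (R1 (R3 y)) (R2 (wedge_prod x z)) - bracket (R3 (bracket (R1 (R3 y)) (R2 x))) (R1 (R2 z))"
      unfolding fold1_prec fold2_wedge by (rule jacobi_exchange) (simp add: expand anticommute)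
    show "bracket (R1 (R2 (R3 x))) (bracket (R1 (R3 y)) (R2 z)) - bracket (R1 (R3 (succ_prod x y))) (R2 z)
        = bracket (R1 (R3 y)) (R2 (vee_prod x z)) - bracket (R1 (R3 (prec_prod y x))) (R2 z)"
      unfolding fold2_vee by (rule jacobi_exchange) (simp add: expand anticommute)
  qed
qed

end
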